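(* The map $\mathrm{J}_1:C^\infty(\mathbb{S}^3)\times\mathrm{CL}\to T^*\mathrm{CL}$, $\mathrm{J}_1(u,T)=d\mathrm{I}[u](T)$, is a submersion, i.e. its derivative is surjective onto the tangent space of $T^*\mathrm{CL}$ at every point.
   Context: $\mathbb{S}^3\subset\mathbb{R}^4=\mathbb{R}^2\times\mathbb{R}^2$ is the unit sphere; $T_0=\{(x,y):\|x\|^2=\|y\|^2=1/2\}$; $\mathrm{CL}=\{MT_0:M\in O(4)\}$ is the 4-dimensional manifold of Clifford tori. For $u\in C^\infty(\mathbb{S}^3)$, $\mathrm{I}[u]\in C^\infty(\mathrm{CL})$ is $\mathrm{I}[u](T)=\int_Tu\,dA_T$. $C^\infty(\mathbb{S}^3)$ is given the smooth (Fréchet) topology. *)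

theory Defs
  imports "HOL-Analysis.Analysis"
begin

text \<open>C-infinity functions on R^4: all iterated partial derivatives exist.
  D xs is the partial derivative along the index list xs.\<close>
definition smooth4 :: "(real^4 \<Rightarrow> real) \<Rightarrow> bool" where
  "smooth4 f \<longleftrightarrow> (\<exists>D :: 4 list \<Rightarrow> real^4 \<Rightarrow> real. D [] = f \<and>
     (\<forall>xs x. (D xs has_derivative (\<lambda>h. \<Sum>i\<in>UNIV. h $ i * D (i # xs) x)) (at x)))"

text \<open>The unit sphere S^3 and C-infinity(S^3) as restrictions of smooth functions on R^4.\<close>
definition S3 :: "(real^4) set" where "S3 = {x. norm x = 1}"

definition Cinf_S3 :: "(real^4 \<Rightarrow> real) set" where
  "Cinf_S3 = {u. \<exists>f. smooth4 f \<and> (\<forall>x\<in>S3. u x = f x) \<and> (\<forall>x. x \<notin> S3 \<longrightarrow> u x = 0)}"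

text \<open>Standard parametrisation of the Clifford torus T0, coordinates (x1,x2,y1,y2).\<close>
definition cliff :: "real \<Rightarrow> real \<Rightarrow> real^4" where
  "cliff s t = vector [cos s / sqrt 2, sin s / sqrt 2, cos t / sqrt 2, sin t / sqrt 2]"

definition T0 :: "(real^4) set" where
  "T0 = {x. (x$1)^2 + (x$2)^2 = 1/2 \<and> (x$3)^2 + (x$4)^2 = 1/2}"

definition CL :: "(real^4) set set" where
  "CL = {((*v) M) ` T0 | M. orthogonal_matrix M}"

text \<open>I[u](T) = integral of u over T w.r.t. area; for T = M T0 the area element
  of the parametrisation cliff is (1/2) ds dt.\<close>
definition Iint :: "(real^4 \<Rightarrow> real) \<Rightarrow> (real^4) set \<Rightarrow> real" where
  "Iint u T = (THE c. \<exists>M. orthogonal_matrix M \<and> T = ((*v) M) ` T0 \<and>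
      c = integral (cbox (0,0) (2*pi, 2*pi)) (\<lambda>(s,t). u (M *v cliff s t) / 2))"

text \<open>Rotation in the (i,j) coordinate plane.\<close>
definition rot :: "4 \<Rightarrow> 4 \<Rightarrow> real \<Rightarrow> real^4^4" where
  "rot i j \<theta> = (\<chi> k l. if k = i \<and> l = i then cos \<theta> else if k = j \<and> l = j then cos \<theta>
      else if k = i \<and> l = j then - sin \<theta> else if k = j \<and> l = i then sin \<theta>
      else if k = l then 1 else 0)"

text \<open>Local chart of CL around M0 T0: the generators E13,E14,E23,E24 complement
  the Lie algebra span(E12,E34) of the stabiliser of T0.\<close>
definition chartCL :: "real^4^4 \<Rightarrow> real^4 \<Rightarrow> (real^4) set" where
  "chartCL M0 a = ((*v) (M0 ** rot 1 3 (a$1) ** rot 1 4 (a$2) ** rot 2 3 (a$3) ** rot 2 4 (a$4))) ` T0"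

text \<open>J1(u,T) = dI[u](T) in the induced canonical chart (a, eta) of T*CL.\<close>
definition J1chart :: "real^4^4 \<Rightarrow> (real^4 \<Rightarrow> real) \<Rightarrow> real^4 \<Rightarrow> (real^4) \<times> (real^4)" where
  "J1chart M0 u a = (a, \<chi> i. frechet_derivative (\<lambda>b. Iint u (chartCL M0 b)) (at a) (axis i 1))"

end

theory Submission
  imports Defs
begin

text \<open>In the chart (a, \<eta>) of the cotangent bundle induced by chartCL M0, J1 becomes
  \<open>(u, a) \<mapsto> (a, \<nabla>F\<^sub>u(a))\<close> with \<open>F\<^sub>u(a) = \<integral>\<integral> u(R(a) cliff(s,t)) / 2\<close>, where R(a) is
  M0 followed by the four plane rotations. Since \<open>F\<^sub>u\<close> is linear in u, the derivative of
  \<open>\<epsilon> \<mapsto> J1(u + \<epsilon> v, \<epsilon> b)\<close> at 0 is \<open>(b, Hess F\<^sub>u(0) b + \<nabla>F\<^sub>v(0))\<close>, so it suffices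
  that \<open>\<nabla>F\<^sub>v(0)\<close> takes every value. For \<open>v = Q P\<close> in the frame M0, where
  \<open>Q = x\<^sub>1\<^sup>2 + x\<^sub>2\<^sup>2 - x\<^sub>3\<^sup>2 - x\<^sub>4\<^sup>2\<close> vanishes on T0 and
  \<open>P = \<Sum> l\<^sub>k x\<^sub>i x\<^sub>j\<close> (\<open>i \<in> {1,2}\<close>, \<open>j \<in> {3,4}\<close>), orthogonality of cos and sin
  on the circle gives \<open>\<nabla>F\<^sub>v(0) = -(\<pi>\<^sup>2/2) l\<close>.

  That I[u](T) does not depend on the orthogonal matrix representing T holds because the
  stabiliser of T0 acts on the angles (s, t) by translations, reflections and the swap,
  all of which preserve the integral of a doubly periodic function.\<close>

section \<open>Parametrising the Clifford torus\<close>

abbreviation angle_box :: "(real \<times> real) set" where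
  "angle_box \<equiv> cbox (0, 0) (2*pi, 2*pi)"

lemma vector_4 [simp]:
  "(vector [x, y, z, w] :: 'a::zero^4) $ 1 = x"
  "(vector [x, y, z, w] :: 'a::zero^4) $ 2 = y"
  "(vector [x, y, z, w] :: 'a::zero^4) $ 3 = z"
  "(vector [x, y, z, w] :: 'a::zero^4) $ 4 = w"
  unfolding vector_def by simp_all

lemma cliff_nth [simp]:
  "cliff s t $ 1 = cos s / sqrt 2" "cliff s t $ 2 = sin s / sqrt 2"
  "cliff s t $ 3 = cos t / sqrt 2" "cliff s t $ 4 = sin t / sqrt 2"
  by (simp_all add: cliff_def)

lemma cliff_periodic [simp]: "cliff (s + 2*pi) t = cliff s t" "cliff s (t + 2*pi) = cliff s t"
  by (simp_all add: cliff_def)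

lemma cliff_in_T0: "cliff s t \<in> T0"
  by (simp add: T0_def power_divide)

lemma norm_cliff: "norm (cliff s t) = 1"
proof -
  have "(norm (cliff s t))\<^sup>2 = (cos s)\<^sup>2 / 2 + (sin s)\<^sup>2 / 2 + (cos t)\<^sup>2 / 2 + (sin t)\<^sup>2 / 2"
    by (simp add: power2_norm_eq_inner inner_vec_def sum_4 power2_eq_square[symmetric] power_divide)
  also have "\<dots> = 1"
    using sin_cos_squared_add[of s] sin_cos_squared_add[of t] by linarith
  finally show ?thesis
    using norm_ge_zero[of "cliff s t"] by (auto simp: power2_eq_1_iff)
qed

lemma norm_orthogonal_matrix_mult: "orthogonal_matrix M \<Longrightarrow> norm (M *v x) = norm (x :: real^'n)"
  by (metis orthogonal_transformation_matrix orthogonal_transformation_norm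
      matrix_of_matrix_vector_mul matrix_vector_mul_linear)

lemma orthogonal_cliff_in_S3: "orthogonal_matrix M \<Longrightarrow> M *v cliff s t \<in> S3"
  by (simp add: S3_def norm_orthogonal_matrix_mult norm_cliff)

lemma continuous_on_cliff [continuous_intros]:
  fixes S :: "'a::metric_space set"
  assumes "continuous_on S f" "continuous_on S g"
  shows "continuous_on S (\<lambda>x. cliff (f x) (g x))"
proof -
  have "cliff s t = (cos s / sqrt 2) *\<^sub>R axis 1 1 + (sin s / sqrt 2) *\<^sub>R axis 2 1
      + (cos t / sqrt 2) *\<^sub>R axis 3 1 + (sin t / sqrt 2) *\<^sub>R axis 4 1" for s t
    by (simp add: vec_eq_iff forall_4 axis_def)
  then show ?thesis by (simp only:) (intro continuous_intros assms, auto)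
qed

lemma orthogonal_matrix_rot:
  "orthogonal_matrix (rot 1 3 \<theta>)" "orthogonal_matrix (rot 1 4 \<theta>)"
  "orthogonal_matrix (rot 2 3 \<theta>)" "orthogonal_matrix (rot 2 4 \<theta>)"
  by (simp_all add: orthogonal_matrix_def rot_def vec_eq_iff forall_4 matrix_matrix_mult_def
      transpose_def sum_4 mat_def power2_eq_square[symmetric])

section \<open>Integrals of periodic functions\<close>

lemma integral_periodic_shift:
  fixes \<phi> :: "real \<Rightarrow> real"
  assumes cont: "continuous_on UNIV \<phi>" and per: "\<And>x. \<phi> (x + 2*pi) = \<phi> x"
  shows "integral {0..2*pi} (\<lambda>s. \<phi> (s + \<beta>)) = integral {0..2*pi} \<phi>"
proof -
  interpret periodic_fun_simple \<phi> "2*pi" by standard (rule per)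
  have int: "\<phi> integrable_on {a..b}" for a b
    by (rule integrable_continuous_interval) (rule continuous_on_subset[OF cont], auto)
  define r where "r = 2*pi * frac (\<beta> / (2*pi))"
  have r: "0 \<le> r" "r \<le> 2*pi"
    using frac_lt_1[of "\<beta> / (2*pi)"] by (simp_all add: r_def)
  have "\<phi> (s + \<beta>) = \<phi> (s + r)" for s
  proof -
    have "s + \<beta> = (s + r) + of_int \<lfloor>\<beta> / (2*pi)\<rfloor> * (2*pi)"
      by (simp add: r_def frac_def algebra_simps)
    then show ?thesis by (simp only: plus_of_int)
  qed
  then have "integral {0..2*pi} (\<lambda>s. \<phi> (s + \<beta>)) = integral {r..2*pi+r} \<phi>"
    using integral_shift_real_ivl[where a=r and c=r and b="2*pi+r" and f=\<phi>] by simp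
  also have "\<dots> = integral {r..2*pi} \<phi> + integral {2*pi..2*pi+r} \<phi>"
    using Henstock_Kurzweil_Integration.integral_combine[of r "2*pi" "2*pi+r" \<phi>] r int by simp
  also have "integral {2*pi..2*pi+r} \<phi> = integral {0..r} \<phi>"
    using integral_shift_real_ivl[where a="2*pi" and c="2*pi" and b="2*pi+r" and f=\<phi>] per by simp
  also have "integral {r..2*pi} \<phi> + integral {0..r} \<phi> = integral {0..2*pi} \<phi>"
    using Henstock_Kurzweil_Integration.integral_combine[of 0 r "2*pi" \<phi>] r int by simp
  finally show ?thesis .
qed

lemma integral_periodic_reflect:
  fixes \<phi> :: "real \<Rightarrow> real"
  assumes cont: "continuous_on UNIV \<phi>" and per: "\<And>x. \<phi> (x + 2*pi) = \<phi> x"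
  shows "integral {0..2*pi} (\<lambda>s. \<phi> (\<beta> - s)) = integral {0..2*pi} \<phi>"
proof -
  define \<psi> where "\<psi> x = \<phi> (x + \<beta>)" for x
  have "integral {0..2*pi} (\<lambda>s. \<phi> (\<beta> - s)) = integral {-2*pi..0} \<psi>"
    using Henstock_Kurzweil_Integration.integral_reflect_real[where a="-2*pi" and b=0 and f=\<psi>] by (simp add: \<psi>_def)
  also have "\<dots> = integral {0..2*pi} (\<lambda>x. \<psi> (x - 2*pi))"
    using integral_shift_real_ivl[where a="-2*pi" and c="-2*pi" and b=0 and f=\<psi>] by simp
  also have "\<dots> = integral {0..2*pi} \<psi>"
  proof -
    have "\<psi> (x - 2*pi) = \<psi> x" for x
      using per[of "x - 2*pi + \<beta>"] by (simp add: \<psi>_def)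
    then show ?thesis by simp
  qed
  also have "\<dots> = integral {0..2*pi} \<phi>"
    unfolding \<psi>_def by (rule integral_periodic_shift[OF cont per])
  finally show ?thesis .
qed

lemma integral_periodic_affine:
  fixes \<phi> :: "real \<Rightarrow> real"
  assumes "continuous_on UNIV \<phi>" "\<And>x. \<phi> (x + 2*pi) = \<phi> x" and "\<epsilon> = 1 \<or> \<epsilon> = -1"
  shows "integral {0..2*pi} (\<lambda>s. \<phi> (\<beta> + \<epsilon> * s)) = integral {0..2*pi} \<phi>"
  using assms integral_periodic_shift[OF assms(1,2), of \<beta>] integral_periodic_reflect[OF assms(1,2), of \<beta>]
  by (auto simp: add.commute)

lemma continuous_on_compose_pair:
  fixes h :: "'a::topological_space \<Rightarrow> 'b::topological_space \<Rightarrow> 'c::topological_space"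
  assumes "continuous_on UNIV (\<lambda>p. h (fst p) (snd p))" "continuous_on S A" "continuous_on S B"
  shows "continuous_on S (\<lambda>x. h (A x) (B x))"
  using continuous_on_compose2[OF assms(1) continuous_on_Pair[OF assms(2,3)]] by simp

lemma integral_angle_box_iterated:
  assumes "continuous_on UNIV (\<lambda>p. F (fst p) (snd p) :: real)"
  shows "integral angle_box (\<lambda>p. F (fst p) (snd p)) =
         integral {0..2*pi} (\<lambda>s. integral {0..2*pi} (\<lambda>t. F s t))"
  using integral_prod_continuous[of 0 0 "2*pi" "2*pi" "\<lambda>p. F (fst p) (snd p)"]
    continuous_on_subset[OF assms] by (simp add: cbox_interval)

lemma integral_angle_box_swap:
  assumes "continuous_on UNIV (\<lambda>p. F (fst p) (snd p) :: real)"
  shows "integral angle_box (\<lambda>p. F (snd p) (fst p)) = integral angle_box (\<lambda>p. F (fst p) (snd p))"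
proof -
  have "continuous_on UNIV (\<lambda>p. F (snd p) (fst p))"
    by (rule continuous_on_compose_pair[OF assms]) (intro continuous_intros)+
  then have "integral angle_box (\<lambda>p. F (snd p) (fst p))
      = integral {0..2*pi} (\<lambda>s. integral {0..2*pi} (\<lambda>t. F t s))"
    by (rule integral_angle_box_iterated[where F="\<lambda>s t. F t s"])
  also have "\<dots> = integral {0..2*pi} (\<lambda>s. integral {0..2*pi} (\<lambda>t. F s t))"
  proof -
    have "continuous_on (cbox (0, 0) (2*pi, 2*pi)) (\<lambda>(x, y). F x y)"
      using continuous_on_subset[OF assms] by (simp add: case_prod_beta')
    from integral_swap_continuous[OF this] show ?thesis by (simp add: cbox_interval)
  qed
  also have "\<dots> = integral angle_box (\<lambda>p. F (fst p) (snd p))"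
    by (rule integral_angle_box_iterated[symmetric, OF assms])
  finally show ?thesis .
qed

lemma integral_angle_box_affine:
  fixes h :: "real \<Rightarrow> real \<Rightarrow> real"
  assumes cont: "continuous_on UNIV (\<lambda>p. h (fst p) (snd p))"
    and per1: "\<And>s t. h (s + 2*pi) t = h s t" and per2: "\<And>s t. h s (t + 2*pi) = h s t"
    and \<epsilon>: "\<epsilon> = 1 \<or> \<epsilon> = -1" and \<delta>: "\<delta> = 1 \<or> \<delta> = -1"
  shows "integral angle_box (\<lambda>p. h (\<beta> + \<epsilon> * fst p) (\<gamma> + \<delta> * snd p))
       = integral angle_box (\<lambda>p. h (fst p) (snd p))"
proof -
  note cont_comp = continuous_on_compose_pair[OF cont]
  have cont1: "continuous_on UNIV (\<lambda>x. h x t)" and cont2: "continuous_on UNIV (\<lambda>x. h s x)" for s t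
    by (rule cont_comp; intro continuous_intros)+
  have "integral angle_box (\<lambda>p. h (\<beta> + \<epsilon> * fst p) (\<gamma> + \<delta> * snd p))
      = integral {0..2*pi} (\<lambda>s. integral {0..2*pi} (\<lambda>t. h (\<beta> + \<epsilon> * s) (\<gamma> + \<delta> * t)))"
    by (rule integral_angle_box_iterated[where F="\<lambda>s t. h (\<beta> + \<epsilon> * s) (\<gamma> + \<delta> * t)"])
       (rule cont_comp; intro continuous_intros)
  also have "\<dots> = integral {0..2*pi} (\<lambda>s. integral {0..2*pi} (\<lambda>t. h (\<beta> + \<epsilon> * s) t))"
    using integral_periodic_affine[OF cont2 per2 \<delta>] by simp
  also have "\<dots> = integral angle_box (\<lambda>p. h (\<beta> + \<epsilon> * fst p) (snd p))"
    by (rule integral_angle_box_iterated[symmetric]) (rule cont_comp; intro continuous_intros)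
  also have "\<dots> = integral angle_box (\<lambda>p. h (\<beta> + \<epsilon> * snd p) (fst p))"
    by (rule integral_angle_box_swap[where F="\<lambda>s t. h (\<beta> + \<epsilon> * t) s"])
       (rule cont_comp; intro continuous_intros)
  also have "\<dots> = integral {0..2*pi} (\<lambda>s. integral {0..2*pi} (\<lambda>t. h (\<beta> + \<epsilon> * t) s))"
    by (rule integral_angle_box_iterated[where F="\<lambda>s t. h (\<beta> + \<epsilon> * t) s"])
       (rule cont_comp; intro continuous_intros)
  also have "\<dots> = integral {0..2*pi} (\<lambda>s. integral {0..2*pi} (\<lambda>t. h t s))"
    using integral_periodic_affine[OF cont1 per1 \<epsilon>] by simp
  also have "\<dots> = integral angle_box (\<lambda>p. h (snd p) (fst p))"
    by (rule integral_angle_box_iterated[where F="\<lambda>s t. h t s", symmetric])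
       (rule cont_comp; intro continuous_intros)
  also have "\<dots> = integral angle_box (\<lambda>p. h (fst p) (snd p))"
    by (rule integral_angle_box_swap[OF cont])
  finally show ?thesis .
qed

section \<open>The stabiliser of the Clifford torus\<close>

lemma orthonormal_pair_angle:
  fixes p q r u :: real
  assumes "p\<^sup>2 + q\<^sup>2 = 1" "r\<^sup>2 + u\<^sup>2 = 1" "p*r + q*u = 0"
  shows "\<exists>\<beta> \<epsilon>. (\<epsilon> = 1 \<or> \<epsilon> = -1) \<and>
    (\<forall>s. p * cos s + r * sin s = cos (\<beta> + \<epsilon> * s) \<and> q * cos s + u * sin s = sin (\<beta> + \<epsilon> * s))"
proof -
  obtain \<beta> where \<beta>: "p = cos \<beta>" "q = sin \<beta>" using sincos_total_2pi[OF assms(1)] by metis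
  define d where "d = p*u - q*r"
  have "d\<^sup>2 = 1" unfolding d_def using assms by algebra
  then have "d = 1 \<or> d = -1" by (simp add: power2_eq_1_iff)
  moreover have "r = - d * q" "u = d * p" unfolding d_def using assms by algebra+
  ultimately show ?thesis
    using \<beta> by (intro exI[of _ \<beta>] exI[of _ d]) (auto simp: cos_add sin_add)
qed

lemma orthogonal_matrix_columns_inner:
  fixes K :: "real^'n^'n"
  assumes "orthogonal_matrix K"
  shows "(\<Sum>r\<in>UNIV. K$r$i * K$r$j) = (if i = j then 1 else 0)"
  using assms unfolding orthogonal_matrix_def
  by (simp add: vec_eq_iff matrix_matrix_mult_def transpose_def mat_def)

lemma orthogonal_matrix_rows_inner:
  fixes K :: "real^'n^'n"
  assumes "orthogonal_matrix K"
  shows "(\<Sum>r\<in>UNIV. K$i$r * K$j$r) = (if i = j then 1 else 0)"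
  using assms unfolding orthogonal_matrix_def
  by (simp add: vec_eq_iff matrix_matrix_mult_def transpose_def mat_def)

text \<open>With \<open>u = (cos s, sin s)\<close>, \<open>w = (cos t, sin t)\<close> the hypothesis says \<open>|A u + B w| = 1\<close>
  for the 2x2 matrices A, B with rows (p1, p2), (q1, q2) and (p3, p4), (q3, q4).\<close>
lemma circle_sum_unit_relations:
  fixes p1 p2 p3 p4 q1 q2 q3 q4 :: real
  assumes E: "\<And>s t. (p1 * cos s + p2 * sin s + p3 * cos t + p4 * sin t)\<^sup>2
                   + (q1 * cos s + q2 * sin s + q3 * cos t + q4 * sin t)\<^sup>2 = 1"
  shows "p1 * p2 + q1 * q2 = 0" "p1 * p3 + q1 * q3 = 0" "p1 * p4 + q1 * q4 = 0"
    and "p1\<^sup>2 + q1\<^sup>2 + p3\<^sup>2 + q3\<^sup>2 = 1" "p1\<^sup>2 + q1\<^sup>2 + p4\<^sup>2 + q4\<^sup>2 = 1"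
    "p2\<^sup>2 + q2\<^sup>2 + p3\<^sup>2 + q3\<^sup>2 = 1"
proof -
  have e1: "(p1 + p3)\<^sup>2 + (q1 + q3)\<^sup>2 = 1" using E[of 0 0] by simp
  have e2: "(- p1 + p3)\<^sup>2 + (- q1 + q3)\<^sup>2 = 1" using E[of pi 0] by simp
  have e3: "(p1 + p4)\<^sup>2 + (q1 + q4)\<^sup>2 = 1" using E[of 0 "pi/2"] by simp
  have e4: "(- p1 + p4)\<^sup>2 + (- q1 + q4)\<^sup>2 = 1" using E[of pi "pi/2"] by simp
  have e5: "(p2 + p3)\<^sup>2 + (q2 + q3)\<^sup>2 = 1" using E[of "pi/2" 0] by simp
  have e6: "(- p2 + p3)\<^sup>2 + (- q2 + q3)\<^sup>2 = 1" using E[of "-pi/2" 0] by simp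
  show "p1 * p3 + q1 * q3 = 0" "p1\<^sup>2 + q1\<^sup>2 + p3\<^sup>2 + q3\<^sup>2 = 1" using e1 e2 by algebra+
  show "p1 * p4 + q1 * q4 = 0" "p1\<^sup>2 + q1\<^sup>2 + p4\<^sup>2 + q4\<^sup>2 = 1" using e3 e4 by algebra+
  show "p2\<^sup>2 + q2\<^sup>2 + p3\<^sup>2 + q3\<^sup>2 = 1" using e5 e6 by algebra
  have p23: "p2 * p3 + q2 * q3 = 0" using e5 e6 by algebra
  define r :: real where "r = sqrt 2 / 2"
  have "(p1 * r + p2 * r + p3)\<^sup>2 + (q1 * r + q2 * r + q3)\<^sup>2 = 1"
    and "(p1 * r - p2 * r + p3)\<^sup>2 + (q1 * r - q2 * r + q3)\<^sup>2 = 1"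
    using E[of "pi/4" 0] E[of "-pi/4" 0] by (simp_all add: r_def cos_45 sin_45)
  then have "4 * r\<^sup>2 * (p1 * p2 + q1 * q2) + 4 * r * (p2 * p3 + q2 * q3) = 0"
    by algebra
  moreover have "r\<^sup>2 = 1/2" "r \<noteq> 0" by (simp_all add: r_def power_divide)
  ultimately show "p1 * p2 + q1 * q2 = 0" using p23 by simp
qed

text \<open>The previous lemma makes the first column of the top two rows of K orthogonal to the
  other three, so orthonormality of those rows gives \<open>\<alpha>\<^sup>2 = \<alpha>\<close> for \<open>\<alpha>\<close> the squared norm
  of that column; \<open>\<alpha> = 1\<close> and \<open>\<alpha> = 0\<close> give the two block shapes.\<close>
lemma clifford_stabilizer_blocks:
  fixes K :: "real^4^4"
  assumes K: "orthogonal_matrix K" and T: "\<And>s t. K *v cliff s t \<in> T0"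
  shows "(K$1$3 = 0 \<and> K$1$4 = 0 \<and> K$2$3 = 0 \<and> K$2$4 = 0 \<and>
          K$3$1 = 0 \<and> K$3$2 = 0 \<and> K$4$1 = 0 \<and> K$4$2 = 0) \<or>
         (K$1$1 = 0 \<and> K$1$2 = 0 \<and> K$2$1 = 0 \<and> K$2$2 = 0 \<and>
          K$3$3 = 0 \<and> K$3$4 = 0 \<and> K$4$3 = 0 \<and> K$4$4 = 0)"
proof -
  define k where "k i j = K$i$j" for i j
  have "(k 1 1 * cos s + k 1 2 * sin s + k 1 3 * cos t + k 1 4 * sin t)\<^sup>2
      + (k 2 1 * cos s + k 2 2 * sin s + k 2 3 * cos t + k 2 4 * sin t)\<^sup>2 = 1" for s t
    using T[of s t]
    by (simp add: T0_def matrix_vector_mult_def sum_4 k_def power_divide add_divide_distrib[symmetric])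
  note circle = circle_sum_unit_relations[OF this]
  note rows = orthogonal_matrix_rows_inner[OF K, folded k_def]
  have c: "(k 1 i)\<^sup>2 + (k 2 i)\<^sup>2 + (k 3 i)\<^sup>2 + (k 4 i)\<^sup>2 = 1" for i
    using orthogonal_matrix_columns_inner[OF K, of i i] by (simp add: sum_4 power2_eq_square k_def)
  have "((k 1 1)\<^sup>2 + (k 2 1)\<^sup>2)\<^sup>2 + (k 1 1 * k 1 2 + k 2 1 * k 2 2)\<^sup>2 + (k 1 1 * k 1 3 + k 2 1 * k 2 3)\<^sup>2
      + (k 1 1 * k 1 4 + k 2 1 * k 2 4)\<^sup>2 = (k 1 1)\<^sup>2 + (k 2 1)\<^sup>2"
    using rows[of 1 1] rows[of 2 2] rows[of 1 2] by (simp add: sum_4 power2_eq_square) algebra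
  then have "((k 1 1)\<^sup>2 + (k 2 1)\<^sup>2)\<^sup>2 = (k 1 1)\<^sup>2 + (k 2 1)\<^sup>2" using circle(1-3) by simp
  then have "(k 1 1)\<^sup>2 + (k 2 1)\<^sup>2 = 1 \<or> (k 1 1)\<^sup>2 + (k 2 1)\<^sup>2 = 0"
    by (metis power2_eq_square mult_cancel_right1)
  then show ?thesis
  proof
    assume L: "(k 1 1)\<^sup>2 + (k 2 1)\<^sup>2 = 1"
    then have "(k 1 2)\<^sup>2 + (k 2 2)\<^sup>2 = 1" using circle(4,6) by linarith
    then show ?thesis using L circle(4,5) c[of 1] c[of 2] by (simp add: k_def)
  next
    assume L: "(k 1 1)\<^sup>2 + (k 2 1)\<^sup>2 = 0"
    then have "(k 1 3)\<^sup>2 + (k 2 3)\<^sup>2 = 1" "(k 1 4)\<^sup>2 + (k 2 4)\<^sup>2 = 1" using circle(4,5) by simp_all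
    moreover from this have "(k 1 2)\<^sup>2 + (k 2 2)\<^sup>2 = 0" using circle(6) by linarith
    ultimately show ?thesis using L c[of 3] c[of 4] by (simp add: k_def)
  qed
qed

lemma clifford_stabilizer:
  fixes K :: "real^4^4"
  assumes K: "orthogonal_matrix K" and T: "\<And>s t. K *v cliff s t \<in> T0"
  obtains \<beta> \<gamma> \<epsilon> \<delta> where "\<epsilon> = 1 \<or> \<epsilon> = -1" "\<delta> = 1 \<or> \<delta> = -1"
    "(\<forall>s t. K *v cliff s t = cliff (\<beta> + \<epsilon> * s) (\<gamma> + \<delta> * t)) \<or>
     (\<forall>s t. K *v cliff s t = cliff (\<beta> + \<epsilon> * t) (\<gamma> + \<delta> * s))"
proof -
  define k where "k i j = K$i$j" for i j
  have Kv: "K *v cliff s t = vector [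
      (k 1 1 * cos s + k 1 2 * sin s + k 1 3 * cos t + k 1 4 * sin t) / sqrt 2,
      (k 2 1 * cos s + k 2 2 * sin s + k 2 3 * cos t + k 2 4 * sin t) / sqrt 2,
      (k 3 1 * cos s + k 3 2 * sin s + k 3 3 * cos t + k 3 4 * sin t) / sqrt 2,
      (k 4 1 * cos s + k 4 2 * sin s + k 4 3 * cos t + k 4 4 * sin t) / sqrt 2]" for s t
    by (simp add: vec_eq_iff forall_4 matrix_vector_mult_def sum_4 k_def add_divide_distrib)
  have cols: "(k 1 i * k 1 j + k 2 i * k 2 j) + (k 3 i * k 3 j + k 4 i * k 4 j) = (if i = j then 1 else 0)"
    for i j using orthogonal_matrix_columns_inner[OF K, of i j] by (simp add: sum_4 k_def add.assoc)
  from clifford_stabilizer_blocks[OF K T, folded k_def] show ?thesis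
  proof (elim disjE conjE)
    assume z: "k 1 3 = 0" "k 1 4 = 0" "k 2 3 = 0" "k 2 4 = 0" "k 3 1 = 0" "k 3 2 = 0" "k 4 1 = 0" "k 4 2 = 0"
    have "(k 1 1)\<^sup>2 + (k 2 1)\<^sup>2 = 1" "(k 1 2)\<^sup>2 + (k 2 2)\<^sup>2 = 1" "k 1 1 * k 1 2 + k 2 1 * k 2 2 = 0"
      and "(k 3 3)\<^sup>2 + (k 4 3)\<^sup>2 = 1" "(k 3 4)\<^sup>2 + (k 4 4)\<^sup>2 = 1" "k 3 3 * k 3 4 + k 4 3 * k 4 4 = 0"
      using cols[of 1 1] cols[of 2 2] cols[of 1 2] cols[of 3 3] cols[of 4 4] cols[of 3 4] z
      by (simp_all add: power2_eq_square)
    from orthonormal_pair_angle[OF this(1-3)] orthonormal_pair_angle[OF this(4-6)] obtain \<beta> \<epsilon> \<gamma> \<delta>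
      where signs: "\<epsilon> = 1 \<or> \<epsilon> = -1" "\<delta> = 1 \<or> \<delta> = -1"
      and \<beta>: "\<forall>s. k 1 1 * cos s + k 1 2 * sin s = cos (\<beta> + \<epsilon> * s) \<and> k 2 1 * cos s + k 2 2 * sin s = sin (\<beta> + \<epsilon> * s)"
      and \<gamma>: "\<forall>s. k 3 3 * cos s + k 3 4 * sin s = cos (\<gamma> + \<delta> * s) \<and> k 4 3 * cos s + k 4 4 * sin s = sin (\<gamma> + \<delta> * s)"
      by blast
    have "\<forall>s t. K *v cliff s t = cliff (\<beta> + \<epsilon> * s) (\<gamma> + \<delta> * t)"
      unfolding Kv using \<beta> \<gamma> z by (simp add: cliff_def)
    with signs that show ?thesis by blast
  next
    assume z: "k 1 1 = 0" "k 1 2 = 0" "k 2 1 = 0" "k 2 2 = 0" "k 3 3 = 0" "k 3 4 = 0" "k 4 3 = 0" "k 4 4 = 0"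
    have "(k 1 3)\<^sup>2 + (k 2 3)\<^sup>2 = 1" "(k 1 4)\<^sup>2 + (k 2 4)\<^sup>2 = 1" "k 1 3 * k 1 4 + k 2 3 * k 2 4 = 0"
      and "(k 3 1)\<^sup>2 + (k 4 1)\<^sup>2 = 1" "(k 3 2)\<^sup>2 + (k 4 2)\<^sup>2 = 1" "k 3 1 * k 3 2 + k 4 1 * k 4 2 = 0"
      using cols[of 3 3] cols[of 4 4] cols[of 3 4] cols[of 1 1] cols[of 2 2] cols[of 1 2] z
      by (simp_all add: power2_eq_square)
    from orthonormal_pair_angle[OF this(1-3)] orthonormal_pair_angle[OF this(4-6)] obtain \<beta> \<epsilon> \<gamma> \<delta>
      where signs: "\<epsilon> = 1 \<or> \<epsilon> = -1" "\<delta> = 1 \<or> \<delta> = -1"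
      and \<beta>: "\<forall>s. k 1 3 * cos s + k 1 4 * sin s = cos (\<beta> + \<epsilon> * s) \<and> k 2 3 * cos s + k 2 4 * sin s = sin (\<beta> + \<epsilon> * s)"
      and \<gamma>: "\<forall>s. k 3 1 * cos s + k 3 2 * sin s = cos (\<gamma> + \<delta> * s) \<and> k 4 1 * cos s + k 4 2 * sin s = sin (\<gamma> + \<delta> * s)"
      by blast
    have "\<forall>s t. K *v cliff s t = cliff (\<beta> + \<epsilon> * t) (\<gamma> + \<delta> * s)"
      unfolding Kv using \<beta> \<gamma> z by (simp add: cliff_def)
    with signs that show ?thesis by blast
  qed
qed

lemma integral_clifford_orthogonal_invariant:
  fixes g :: "real^4 \<Rightarrow> real"
  assumes g: "continuous_on UNIV g" and M: "orthogonal_matrix M" and N: "orthogonal_matrix N"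
    and same: "(*v) M ` T0 = (*v) N ` T0"
  shows "integral angle_box (\<lambda>p. g (N *v cliff (fst p) (snd p)))
       = integral angle_box (\<lambda>p. g (M *v cliff (fst p) (snd p)))"
proof -
  define K where "K = transpose M ** N"
  have K: "orthogonal_matrix K" unfolding K_def using M N by (simp add: orthogonal_matrix_mul)
  have N_eq: "N *v x = M *v (K *v x)" for x
    using M by (simp add: K_def matrix_vector_mul_assoc matrix_mul_assoc orthogonal_matrix_def)
  have "K *v cliff s t \<in> T0" for s t
  proof -
    obtain q where "q \<in> T0" "N *v cliff s t = M *v q" using same cliff_in_T0 by blast
    moreover have "K *v cliff s t = transpose M *v (N *v cliff s t)"
      by (simp add: K_def matrix_vector_mul_assoc)
    ultimately show ?thesis
      using M by (simp add: matrix_vector_mul_assoc orthogonal_matrix_def)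
  qed
  then obtain \<beta> \<gamma> \<epsilon> \<delta> where \<epsilon>: "\<epsilon> = 1 \<or> \<epsilon> = -1" and \<delta>: "\<delta> = 1 \<or> \<delta> = -1" and
    K_cliff: "(\<forall>s t. K *v cliff s t = cliff (\<beta> + \<epsilon> * s) (\<gamma> + \<delta> * t)) \<or>
              (\<forall>s t. K *v cliff s t = cliff (\<beta> + \<epsilon> * t) (\<gamma> + \<delta> * s))"
    by (rule clifford_stabilizer[OF K])
  define h where "h s t = g (M *v cliff s t)" for s t
  have h: "continuous_on UNIV (\<lambda>p. h (fst p) (snd p))" unfolding h_def
    by (rule continuous_on_compose2[OF g])
       (auto intro!: continuous_intros bounded_linear.continuous_on[OF matrix_vector_mul_bounded_linear])
  have invariant: "integral angle_box (\<lambda>p. h (\<beta> + \<epsilon> * fst p) (\<gamma> + \<delta> * snd p))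
      = integral angle_box (\<lambda>p. h (fst p) (snd p))"
    by (rule integral_angle_box_affine[OF h _ _ \<epsilon> \<delta>]) (simp_all add: h_def)
  from K_cliff show ?thesis
  proof
    assume "\<forall>s t. K *v cliff s t = cliff (\<beta> + \<epsilon> * s) (\<gamma> + \<delta> * t)"
    then have "integral angle_box (\<lambda>p. g (N *v cliff (fst p) (snd p)))
        = integral angle_box (\<lambda>p. h (\<beta> + \<epsilon> * fst p) (\<gamma> + \<delta> * snd p))"
      by (simp add: N_eq h_def)
    then show ?thesis using invariant by (simp add: h_def)
  next
    assume "\<forall>s t. K *v cliff s t = cliff (\<beta> + \<epsilon> * t) (\<gamma> + \<delta> * s)"
    then have "integral angle_box (\<lambda>p. g (N *v cliff (fst p) (snd p)))
        = integral angle_box (\<lambda>p. h (\<beta> + \<epsilon> * snd p) (\<gamma> + \<delta> * fst p))"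
      by (simp add: N_eq h_def)
    also have "\<dots> = integral angle_box (\<lambda>p. h (\<beta> + \<epsilon> * fst p) (\<gamma> + \<delta> * snd p))"
      by (rule integral_angle_box_swap[where F="\<lambda>s t. h (\<beta> + \<epsilon> * s) (\<gamma> + \<delta> * t)"])
         (rule continuous_on_compose_pair[OF h]; intro continuous_intros)
    finally show ?thesis using invariant by (simp add: h_def)
  qed
qed

lemma Iint_orthogonal_image:
  assumes M: "orthogonal_matrix M" and w: "\<forall>x\<in>S3. w x = f x" and f: "continuous_on UNIV f"
  shows "Iint w ((*v) M ` T0) = integral angle_box (\<lambda>p. f (M *v cliff (fst p) (snd p)) / 2)"
proof -
  have on_S3: "(\<lambda>(s, t). w (N *v cliff s t) / 2) = (\<lambda>p. f (N *v cliff (fst p) (snd p)) / 2)"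
    if "orthogonal_matrix N" for N
    using w orthogonal_cliff_in_S3[OF that] by (auto simp: fun_eq_iff)
  have "continuous_on UNIV (\<lambda>x. f x / 2)" by (intro continuous_intros f) simp
  note invariant = integral_clifford_orthogonal_invariant[OF this M]
  show ?thesis
    unfolding Iint_def
  proof (rule the_equality)
    show "\<exists>N. orthogonal_matrix N \<and> (*v) M ` T0 = (*v) N ` T0 \<and>
        integral angle_box (\<lambda>p. f (M *v cliff (fst p) (snd p)) / 2) =
        integral angle_box (\<lambda>(s, t). w (N *v cliff s t) / 2)"
      using M by (intro exI[of _ M]) (simp add: on_S3[OF M])
  next
    fix c assume "\<exists>N. orthogonal_matrix N \<and> (*v) M ` T0 = (*v) N ` T0 \<and>
        c = integral angle_box (\<lambda>(s, t). w (N *v cliff s t) / 2)"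
    then obtain N where N: "orthogonal_matrix N" "(*v) M ` T0 = (*v) N ` T0"
      and c: "c = integral angle_box (\<lambda>(s, t). w (N *v cliff s t) / 2)" by blast
    show "c = integral angle_box (\<lambda>p. f (M *v cliff (fst p) (snd p)) / 2)"
      unfolding c on_S3[OF N(1)] by (rule invariant[OF N])
  qed
qed

section \<open>Differentiating the integral in the chart\<close>

definition derivative_tower :: "(4 list \<Rightarrow> real^4 \<Rightarrow> real) \<Rightarrow> bool" where
  "derivative_tower D \<longleftrightarrow> (\<forall>xs x. (D xs has_derivative (\<lambda>h. \<Sum>i\<in>UNIV. h $ i * D (i # xs) x)) (at x))"

lemma smooth4_iff_derivative_tower: "smooth4 f \<longleftrightarrow> (\<exists>D. D [] = f \<and> derivative_tower D)"
  unfolding smooth4_def derivative_tower_def by blast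

lemma Cinf_S3_derivative_tower:
  assumes "u \<in> Cinf_S3"
  obtains D where "derivative_tower D" "\<forall>x\<in>S3. u x = D [] x"
  using assms unfolding Cinf_S3_def smooth4_iff_derivative_tower by auto

lemma derivative_tower_continuous_on [continuous_intros]:
  assumes "derivative_tower D" "continuous_on S f"
  shows "continuous_on S (\<lambda>x. D xs (f x))"
proof -
  have "continuous_on UNIV (D xs)"
    using assms(1) unfolding derivative_tower_def
    by (meson continuous_at_imp_continuous_on has_derivative_continuous)
  then show ?thesis using continuous_on_compose2[OF _ assms(2)] by blast
qed

lemma derivative_tower_lincomb:
  assumes "derivative_tower Du" "derivative_tower Dv"
  shows "derivative_tower (\<lambda>xs x. Du xs x + e * Dv xs x)"
  unfolding derivative_tower_def
proof (intro allI)
  fix xs x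
  have "(Du xs has_derivative (\<lambda>h. \<Sum>i\<in>UNIV. h $ i * Du (i # xs) x)) (at x)"
    "(Dv xs has_derivative (\<lambda>h. \<Sum>i\<in>UNIV. h $ i * Dv (i # xs) x)) (at x)"
    using assms unfolding derivative_tower_def by blast+
  from has_derivative_add[OF this(1) has_derivative_mult_right[OF this(2)]]
  show "((\<lambda>x. Du xs x + e * Dv xs x) has_derivative
      (\<lambda>h. \<Sum>i\<in>UNIV. h $ i * (Du (i # xs) x + e * Dv (i # xs) x))) (at x)"
    by (simp add: sum.distrib sum_distrib_left algebra_simps)
qed

lemma has_derivative_vec_componentwise:
  fixes f :: "'a::real_normed_vector \<Rightarrow> real^'n"
  assumes "\<And>k. ((\<lambda>x. f x $ k) has_derivative (\<lambda>h. f' h $ k)) (at x)"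
  shows "(f has_derivative f') (at x)"
  using assms
  by (subst has_derivative_componentwise_within) (auto simp: Basis_vec_def cart_eq_inner_axis[symmetric])

text \<open>The n-th derivative in \<theta> of rot i j \<theta> *v w: shifting the angle by \<open>n \<pi>/2\<close>
  turns cos and sin into their n-th derivatives.\<close>
definition rot_diff :: "4 \<Rightarrow> 4 \<Rightarrow> nat \<Rightarrow> real \<Rightarrow> real^4 \<Rightarrow> real^4" where
  "rot_diff i j n \<theta> w = (\<chi> k.
     if k = i then cos (\<theta> + real n * pi / 2) * w$i - sin (\<theta> + real n * pi / 2) * w$j
     else if k = j then sin (\<theta> + real n * pi / 2) * w$i + cos (\<theta> + real n * pi / 2) * w$j
     else if n = 0 then w$k else 0)"

lemma rot_mult_eq_rot_diff:
  "rot 1 3 \<theta> *v w = rot_diff 1 3 0 \<theta> w" "rot 1 4 \<theta> *v w = rot_diff 1 4 0 \<theta> w"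
  "rot 2 3 \<theta> *v w = rot_diff 2 3 0 \<theta> w" "rot 2 4 \<theta> *v w = rot_diff 2 4 0 \<theta> w"
  unfolding rot_def rot_diff_def
  by (simp_all add: vec_eq_iff forall_4 matrix_vector_mult_def sum_4)

lemma linear_rot_diff: "linear (rot_diff i j n \<theta>)"
  by (rule linearI) (simp_all add: rot_diff_def vec_eq_iff algebra_simps)

lemma continuous_on_rot_diff [continuous_intros]:
  fixes S :: "'a::metric_space set"
  assumes "continuous_on S f" "continuous_on S w"
  shows "continuous_on S (\<lambda>x. rot_diff i j n (f x) (w x))"
  unfolding rot_diff_def
proof (rule continuous_on_vec_lambda)
  fix k :: 4
  have "continuous_on S (\<lambda>x. f x + real n * pi / 2)" by (intro continuous_intros assms)
  note trig = continuous_on_cos[OF this] continuous_on_sin[OF this]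
  show "continuous_on S (\<lambda>x.
     if k = i then cos (f x + real n * pi / 2) * w x $ i - sin (f x + real n * pi / 2) * w x $ j
     else if k = j then sin (f x + real n * pi / 2) * w x $ i + cos (f x + real n * pi / 2) * w x $ j
     else if n = 0 then w x $ k else 0)"
    by (cases "k = i"; cases "k = j"; cases "n = 0") (simp_all add: continuous_intros trig assms)
qed

lemma cos_sin_add_Suc_half_pi:
  "cos (x + real (Suc n) * pi / 2) = - sin (x + real n * pi / 2)"
  "sin (x + real (Suc n) * pi / 2) = cos (x + real n * pi / 2)"
proof -
  have "x + real (Suc n) * pi / 2 = (x + real n * pi / 2) + pi / 2" by (simp add: field_simps)
  then show "cos (x + real (Suc n) * pi / 2) = - sin (x + real n * pi / 2)"
    "sin (x + real (Suc n) * pi / 2) = cos (x + real n * pi / 2)"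
    by (simp_all only:) (simp_all add: cos_add sin_add)
qed

lemma has_derivative_rot_diff:
  assumes "i \<noteq> j" and w: "(w has_derivative w') (at a)"
  shows "((\<lambda>a. rot_diff i j n (a$k) (w a)) has_derivative
     (\<lambda>h. h$k *\<^sub>R rot_diff i j (Suc n) (a$k) (w a) + rot_diff i j n (a$k) (w' h))) (at a)"
proof -
  have w_nth: "((\<lambda>a. w a $ m) has_derivative (\<lambda>h. w' h $ m)) (at a)" for m
    using bounded_linear.has_derivative[OF bounded_linear_vec_nth w] .
  have a_nth: "((\<lambda>a. a $ k) has_derivative (\<lambda>h. h $ k)) (at a)"
    using bounded_linear.has_derivative[OF bounded_linear_vec_nth has_derivative_ident] .
  have trig: "((\<lambda>a. cos (a$k + real n * pi / 2)) has_derivative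
        (\<lambda>h. h$k * - sin (a$k + real n * pi / 2))) (at a)"
    "((\<lambda>a. sin (a$k + real n * pi / 2)) has_derivative
        (\<lambda>h. h$k * cos (a$k + real n * pi / 2))) (at a)"
    using has_derivative_compose[OF has_derivative_add_const[OF a_nth] DERIV_cos[unfolded has_field_derivative_def]]
      has_derivative_compose[OF has_derivative_add_const[OF a_nth] DERIV_sin[unfolded has_field_derivative_def]]
    by (auto simp: mult.commute)
  show ?thesis
  proof (rule has_derivative_vec_componentwise)
    fix m
    consider "m = i" | "m = j" | "m \<noteq> i" "m \<noteq> j" by blast
    then show "((\<lambda>a. rot_diff i j n (a$k) (w a) $ m) has_derivative
      (\<lambda>h. (h$k *\<^sub>R rot_diff i j (Suc n) (a$k) (w a) + rot_diff i j n (a$k) (w' h)) $ m)) (at a)"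
    proof cases
      case 1
      show ?thesis unfolding rot_diff_def cos_sin_add_Suc_half_pi
        by (simp add: 1 \<open>i \<noteq> j\<close>, rule has_derivative_eq_rhs,
            (rule has_derivative_diff has_derivative_mult trig w_nth)+) (simp add: algebra_simps)
    next
      case 2
      show ?thesis unfolding rot_diff_def cos_sin_add_Suc_half_pi
        by (simp add: 2 not_sym[OF \<open>i \<noteq> j\<close>], rule has_derivative_eq_rhs,
            (rule has_derivative_add has_derivative_mult trig w_nth)+) (simp add: algebra_simps)
    qed (cases "n = 0"; simp add: rot_diff_def w_nth)
  qed
qed

text \<open>The partial derivative of order n (a multi-index) with respect to a of
  M rot13(a1) rot14(a2) rot23(a3) rot24(a4) c.\<close>
definition chart_diff :: "real^4^4 \<Rightarrow> (4 \<Rightarrow> nat) \<Rightarrow> real^4 \<Rightarrow> real^4 \<Rightarrow> real^4" where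
  "chart_diff M n a c = M *v rot_diff 1 3 (n 1) (a$1) (rot_diff 1 4 (n 2) (a$2)
     (rot_diff 2 3 (n 3) (a$3) (rot_diff 2 4 (n 4) (a$4) c)))"

lemma chart_diff_0:
  "(M ** rot 1 3 (a$1) ** rot 1 4 (a$2) ** rot 2 3 (a$3) ** rot 2 4 (a$4)) *v c = chart_diff M (\<lambda>_. 0) a c"
  by (simp add: chart_diff_def matrix_vector_mul_assoc[symmetric] rot_mult_eq_rot_diff)

lemma chart_diff_matrix: "chart_diff M n a c = M *v chart_diff (mat 1) n a c"
  by (simp add: chart_diff_def)

lemma continuous_on_chart_diff [continuous_intros]:
  fixes S :: "'a::metric_space set"
  assumes "continuous_on S f" "continuous_on S g"
  shows "continuous_on S (\<lambda>x. chart_diff M n (f x) (g x))"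
  unfolding chart_diff_def
  by (intro bounded_linear.continuous_on[OF matrix_vector_mul_bounded_linear] continuous_intros assms)

lemma has_derivative_chart_diff:
  "((\<lambda>a. chart_diff M n a c) has_derivative
    (\<lambda>h. \<Sum>k\<in>UNIV. h$k *\<^sub>R chart_diff M (n(k := Suc (n k))) a c)) (at a)"
proof -
  note linear_rot = linear_add[OF linear_rot_diff] linear_scale[OF linear_rot_diff] linear_0[OF linear_rot_diff]
  have "((\<lambda>a. rot_diff 2 4 (n 4) (a$4) c) has_derivative
      (\<lambda>h. h$4 *\<^sub>R rot_diff 2 4 (Suc (n 4)) (a$4) c)) (at a)"
    using has_derivative_rot_diff[of 2 4 "\<lambda>a. c" "\<lambda>h. 0" a "n 4" 4] by (simp add: linear_rot)
  note d3 = has_derivative_rot_diff[OF _ this, of 2 3 "n 3" 3, simplified]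
  note d2 = has_derivative_rot_diff[OF _ d3, of 1 4 "n 2" 2, simplified]
  note d1 = has_derivative_rot_diff[OF _ d2, of 1 3 "n 1" 1, simplified]
  show ?thesis
    unfolding chart_diff_def
    by (rule has_derivative_eq_rhs[OF bounded_linear.has_derivative[OF matrix_vector_mul_bounded_linear d1]])
       (simp add: sum_4 linear_rot matrix_vector_right_distrib algebra_simps)
qed

lemma has_derivative_tower_chart_diff:
  assumes "derivative_tower D"
  shows "((\<lambda>a. D xs (chart_diff M n a c)) has_derivative (\<lambda>h. \<Sum>k\<in>UNIV. h$k *
      (\<Sum>i\<in>UNIV. D (i # xs) (chart_diff M n a c) * chart_diff M (n(k := Suc (n k))) a c $ i))) (at a)"
proof -
  have "(D xs has_derivative (\<lambda>h. \<Sum>i\<in>UNIV. h $ i * D (i # xs) (chart_diff M n a c))) (at (chart_diff M n a c))"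
    using assms unfolding derivative_tower_def by blast
  moreover have "(\<lambda>h. \<Sum>i\<in>UNIV. (\<Sum>k\<in>UNIV. h$k *\<^sub>R chart_diff M (n(k := Suc (n k))) a c) $ i
        * D (i # xs) (chart_diff M n a c)) = (\<lambda>h. \<Sum>k\<in>UNIV. h$k *
        (\<Sum>i\<in>UNIV. D (i # xs) (chart_diff M n a c) * chart_diff M (n(k := Suc (n k))) a c $ i))"
  proof
    fix h :: "real^4"
    let ?P = "\<lambda>k. chart_diff M (n(k := Suc (n k))) a c" and ?D = "\<lambda>i. D (i # xs) (chart_diff M n a c)"
    have "(\<Sum>i\<in>UNIV. (\<Sum>k\<in>UNIV. h$k *\<^sub>R ?P k) $ i * ?D i)
        = (\<Sum>i\<in>UNIV. \<Sum>k\<in>UNIV. h$k * (?D i * ?P k $ i))"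
      by (simp add: sum_component sum_distrib_left sum_distrib_right mult_ac)
    also have "\<dots> = (\<Sum>k\<in>UNIV. h$k * (\<Sum>i\<in>UNIV. ?D i * ?P k $ i))"
      by (subst sum.swap) (simp add: sum_distrib_left)
    finally show "(\<Sum>i\<in>UNIV. (\<Sum>k\<in>UNIV. h$k *\<^sub>R ?P k) $ i * ?D i)
        = (\<Sum>k\<in>UNIV. h$k * (\<Sum>i\<in>UNIV. ?D i * ?P k $ i))" .
  qed
  ultimately show ?thesis
    by (rule has_derivative_eq_rhs[OF has_derivative_compose[OF has_derivative_chart_diff]])
qed

lemma has_derivative_integral_parametric:
  fixes \<phi> :: "real^'n \<Rightarrow> 'b::euclidean_space \<Rightarrow> real" and g :: "'n \<Rightarrow> real^'n \<Rightarrow> 'b \<Rightarrow> real"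
  assumes \<phi>: "\<And>a t. ((\<lambda>a. \<phi> a t) has_derivative (\<lambda>h. \<Sum>k\<in>UNIV. h$k * g k a t)) (at a)"
    and g_cont: "\<And>k. continuous_on UNIV (\<lambda>p. g k (fst p) (snd p))"
    and \<phi>_cont: "continuous_on UNIV (\<lambda>p. \<phi> (fst p) (snd p))"
  shows "((\<lambda>a. integral (cbox x y) (\<phi> a)) has_derivative
          (\<lambda>h. \<Sum>k\<in>UNIV. h$k * integral (cbox x y) (g k a))) (at a)"
proof -
  define G where "G a t = blinfun_inner_left (\<chi> k. g k a t)" for a t
  have G_apply: "blinfun_apply (G a t) = (\<lambda>h. \<Sum>k\<in>UNIV. h$k * g k a t)" for a t
    by (auto simp: G_def inner_vec_def)
  have section_cont: "continuous_on (cbox x y) (\<lambda>t. f (a, t))"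
    if "continuous_on UNIV f" for a and f :: "(real^'n) \<times> 'b \<Rightarrow> 'c::topological_space"
    by (rule continuous_on_compose2[OF that]) (auto intro!: continuous_intros)
  have g_section: "continuous_on (cbox x y) (g k a)" for k
    using section_cont[OF g_cont[of k], of a] by simp
  have G_cont: "continuous_on UNIV (\<lambda>p. G (fst p) (snd p))"
    unfolding G_def by (intro continuous_intros g_cont)
  have "((\<lambda>a. integral (cbox x y) (\<phi> a)) has_derivative integral (cbox x y) (G a)) (at a within UNIV)"
  proof (rule leibniz_rule[where fx=G])
    show "continuous_on (UNIV \<times> cbox x y) (\<lambda>(a, t). G a t)"
      using continuous_on_subset[OF G_cont] by (simp add: case_prod_beta')
  qed (use \<phi> G_apply section_cont[OF \<phi>_cont] in \<open>auto intro: integrable_continuous\<close>)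
  moreover have "blinfun_apply (integral (cbox x y) (G a))
     = (\<lambda>h. \<Sum>k\<in>UNIV. h$k * integral (cbox x y) (g k a))"
  proof
    fix h
    have "blinfun_apply (integral (cbox x y) (G a)) h = integral (cbox x y) (\<lambda>t. \<Sum>k\<in>UNIV. h$k * g k a t)"
      using blinfun_apply_integral[OF integrable_continuous[OF section_cont[OF G_cont]]] G_apply by simp
    also have "\<dots> = (\<Sum>k\<in>UNIV. integral (cbox x y) (\<lambda>t. h$k * g k a t))"
      by (rule integral_sum) (auto intro!: integrable_continuous continuous_intros g_section)
    finally show "blinfun_apply (integral (cbox x y) (G a)) h
      = (\<Sum>k\<in>UNIV. h$k * integral (cbox x y) (g k a))" by simp
  qed
  ultimately show ?thesis by simp
qed

abbreviation cliff_pt :: "real \<times> real \<Rightarrow> real^4" where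
  "cliff_pt p \<equiv> cliff (fst p) (snd p)"

definition unit_index :: "4 \<Rightarrow> 4 \<Rightarrow> nat" where
  "unit_index k = (\<lambda>_. 0)(k := 1)"

text \<open>For a derivative tower D of f: the integrand of
  \<open>F(a) = \<integral>\<integral> f(chart_diff M 0 a (cliff s t)) / 2\<close> and those of its first and second
  partial derivatives in a.\<close>
definition chart_integrand ::
    "(4 list \<Rightarrow> real^4 \<Rightarrow> real) \<Rightarrow> real^4^4 \<Rightarrow> real^4 \<Rightarrow> real \<times> real \<Rightarrow> real" where
  "chart_integrand D M a p = D [] (chart_diff M (\<lambda>_. 0) a (cliff_pt p)) / 2"

definition chart_integrand_grad ::
    "(4 list \<Rightarrow> real^4 \<Rightarrow> real) \<Rightarrow> real^4^4 \<Rightarrow> 4 \<Rightarrow> real^4 \<Rightarrow> real \<times> real \<Rightarrow> real" where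
  "chart_integrand_grad D M k a p = (\<Sum>i\<in>UNIV. D [i] (chart_diff M (\<lambda>_. 0) a (cliff_pt p))
     * chart_diff M (unit_index k) a (cliff_pt p) $ i) / 2"

definition chart_integrand_hess ::
    "(4 list \<Rightarrow> real^4 \<Rightarrow> real) \<Rightarrow> real^4^4 \<Rightarrow> 4 \<Rightarrow> 4 \<Rightarrow> real^4 \<Rightarrow> real \<times> real \<Rightarrow> real" where
  "chart_integrand_hess D M k l a p = (\<Sum>i\<in>UNIV.
     (\<Sum>m\<in>UNIV. D [m, i] (chart_diff M (\<lambda>_. 0) a (cliff_pt p)) * chart_diff M (unit_index l) a (cliff_pt p) $ m)
       * chart_diff M (unit_index k) a (cliff_pt p) $ i
     + D [i] (chart_diff M (\<lambda>_. 0) a (cliff_pt p))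
       * chart_diff M ((unit_index k)(l := Suc (unit_index k l))) a (cliff_pt p) $ i) / 2"

definition chart_integral :: "(4 list \<Rightarrow> real^4 \<Rightarrow> real) \<Rightarrow> real^4^4 \<Rightarrow> real^4 \<Rightarrow> real" where
  "chart_integral D M a = integral angle_box (chart_integrand D M a)"

definition chart_gradient :: "(4 list \<Rightarrow> real^4 \<Rightarrow> real) \<Rightarrow> real^4^4 \<Rightarrow> real^4 \<Rightarrow> real^4" where
  "chart_gradient D M a = (\<chi> k. integral angle_box (chart_integrand_grad D M k a))"

definition chart_hessian :: "(4 list \<Rightarrow> real^4 \<Rightarrow> real) \<Rightarrow> real^4^4 \<Rightarrow> real^4 \<Rightarrow> real^4 \<Rightarrow> real^4" where
  "chart_hessian D M a h = (\<chi> k. \<Sum>l\<in>UNIV. h$l * integral angle_box (chart_integrand_hess D M k l a))"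

lemma has_derivative_chart_integrand:
  assumes "derivative_tower D"
  shows "((\<lambda>a. chart_integrand D M a p) has_derivative
           (\<lambda>h. \<Sum>k\<in>UNIV. h$k * chart_integrand_grad D M k a p)) (at a)"
  unfolding chart_integrand_def chart_integrand_grad_def
  by (rule has_derivative_eq_rhs[OF has_derivative_divide'[OF
        has_derivative_tower_chart_diff[OF assms] has_derivative_const]])
     (simp_all add: fun_eq_iff unit_index_def sum_divide_distrib[symmetric])

lemma has_derivative_chart_integrand_grad:
  assumes "derivative_tower D"
  shows "((\<lambda>a. chart_integrand_grad D M k a p) has_derivative
           (\<lambda>h. \<Sum>l\<in>UNIV. h$l * chart_integrand_hess D M k l a p)) (at a)"
proof -
  let ?c = "cliff_pt p"
  define A where "A i = D [i] (chart_diff M (\<lambda>_. 0) a ?c)" for i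
  define B where "B i = chart_diff M (unit_index k) a ?c $ i" for i
  define \<alpha> where "\<alpha> l i = (\<Sum>m\<in>UNIV. D [m, i] (chart_diff M (\<lambda>_. 0) a ?c) * chart_diff M (unit_index l) a ?c $ m)"
    for l i
  define \<beta> where "\<beta> l i = chart_diff M ((unit_index k)(l := Suc (unit_index k l))) a ?c $ i" for l i
  have A: "((\<lambda>a. D [i] (chart_diff M (\<lambda>_. 0) a ?c)) has_derivative (\<lambda>h. \<Sum>l\<in>UNIV. h$l * \<alpha> l i)) (at a)" for i
    using has_derivative_tower_chart_diff[OF assms, of "[i]" M "\<lambda>_. 0" ?c a] by (simp add: \<alpha>_def unit_index_def)
  have B: "((\<lambda>a. chart_diff M (unit_index k) a ?c $ i) has_derivative (\<lambda>h. \<Sum>l\<in>UNIV. h$l * \<beta> l i)) (at a)" for i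
    using bounded_linear.has_derivative[OF bounded_linear_vec_nth[of i] has_derivative_chart_diff]
    by (simp add: \<beta>_def)
  have "((\<lambda>a. chart_integrand_grad D M k a p) has_derivative
      (\<lambda>h. (\<Sum>i\<in>UNIV. A i * (\<Sum>l\<in>UNIV. h$l * \<beta> l i) + (\<Sum>l\<in>UNIV. h$l * \<alpha> l i) * B i) / 2)) (at a)"
    unfolding chart_integrand_grad_def A_def B_def
    by (intro bounded_linear.has_derivative[OF bounded_linear_divide] has_derivative_sum has_derivative_mult A B)
  moreover have "(\<Sum>i\<in>UNIV. A i * (\<Sum>l\<in>UNIV. h$l * \<beta> l i) + (\<Sum>l\<in>UNIV. h$l * \<alpha> l i) * B i)
      = (\<Sum>l\<in>UNIV. h$l * (\<Sum>i\<in>UNIV. \<alpha> l i * B i + A i * \<beta> l i))" for h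
  proof -
    have "(\<Sum>i\<in>UNIV. A i * (\<Sum>l\<in>UNIV. h$l * \<beta> l i) + (\<Sum>l\<in>UNIV. h$l * \<alpha> l i) * B i)
        = (\<Sum>i\<in>UNIV. \<Sum>l\<in>UNIV. h$l * (\<alpha> l i * B i + A i * \<beta> l i))"
      by (simp add: sum_distrib_left sum_distrib_right sum.distrib[symmetric] algebra_simps)
    also have "\<dots> = (\<Sum>l\<in>UNIV. h$l * (\<Sum>i\<in>UNIV. \<alpha> l i * B i + A i * \<beta> l i))"
      by (subst sum.swap) (simp add: sum_distrib_left)
    finally show ?thesis .
  qed
  ultimately show ?thesis
    by (simp add: chart_integrand_hess_def A_def B_def \<alpha>_def \<beta>_def sum_divide_distrib[symmetric])
qed

lemma continuous_on_chart_integrands: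
  assumes "derivative_tower D"
  shows "continuous_on UNIV (\<lambda>q. chart_integrand D M (fst q) (snd q))"
    and "continuous_on UNIV (\<lambda>q. chart_integrand_grad D M k (fst q) (snd q))"
    and "continuous_on UNIV (\<lambda>q. chart_integrand_hess D M k l (fst q) (snd q))"
  unfolding chart_integrand_def chart_integrand_grad_def chart_integrand_hess_def
  by (intro continuous_intros assms; simp)+

lemma has_derivative_chart_integral:
  assumes "derivative_tower D"
  shows "(chart_integral D M has_derivative (\<lambda>h. h \<bullet> chart_gradient D M a)) (at a)"
proof -
  have "chart_integral D M = (\<lambda>a. integral angle_box (chart_integrand D M a))"
    by (simp add: fun_eq_iff chart_integral_def)
  then show ?thesis
    using has_derivative_integral_parametric[OF has_derivative_chart_integrand[OF assms]
        continuous_on_chart_integrands(2,1)[OF assms]]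
    by (simp add: chart_gradient_def inner_vec_def)
qed

lemma has_derivative_chart_gradient:
  assumes "derivative_tower D"
  shows "(chart_gradient D M has_derivative chart_hessian D M a) (at a)"
  unfolding chart_gradient_def chart_hessian_def
  by (rule has_derivative_vec_componentwise)
     (simp add: has_derivative_integral_parametric has_derivative_chart_integrand_grad
       continuous_on_chart_integrands assms)

lemma Iint_chartCL:
  assumes M0: "orthogonal_matrix M0" and w: "\<forall>x\<in>S3. w x = D [] x" and D: "derivative_tower D"
  shows "Iint w (chartCL M0 a) = chart_integral D M0 a"
proof -
  have "orthogonal_matrix (M0 ** rot 1 3 (a$1) ** rot 1 4 (a$2) ** rot 2 3 (a$3) ** rot 2 4 (a$4))"
    by (intro orthogonal_matrix_mul M0 orthogonal_matrix_rot)
  moreover have "continuous_on UNIV (D [])" by (intro continuous_intros D)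
  ultimately have "Iint w (chartCL M0 a) = integral angle_box (\<lambda>p.
      D [] ((M0 ** rot 1 3 (a$1) ** rot 1 4 (a$2) ** rot 2 3 (a$3) ** rot 2 4 (a$4)) *v cliff_pt p) / 2)"
    unfolding chartCL_def by (rule Iint_orthogonal_image[OF _ w])
  then show ?thesis by (simp add: chart_integral_def chart_integrand_def[abs_def] chart_diff_0)
qed

lemma J1chart_eq:
  assumes "orthogonal_matrix M0" and "\<forall>x\<in>S3. w x = D [] x" and D: "derivative_tower D"
  shows "J1chart M0 w a = (a, chart_gradient D M0 a)"
proof -
  have "(\<lambda>b. Iint w (chartCL M0 b)) = chart_integral D M0"
    using Iint_chartCL[OF assms] by (simp add: fun_eq_iff)
  then show ?thesis
    unfolding J1chart_def
    by (simp add: frechet_derivative_at[OF has_derivative_chart_integral[OF D], symmetric] inner_axis' vec_eq_iff)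
qed

lemma chart_gradient_lincomb:
  assumes Du: "derivative_tower Du" and Dv: "derivative_tower Dv"
  shows "chart_gradient (\<lambda>xs x. Du xs x + e * Dv xs x) M a = chart_gradient Du M a + e *\<^sub>R chart_gradient Dv M a"
proof -
  have integrable: "chart_integrand_grad D M k a integrable_on angle_box" if "derivative_tower D" for D k
    using continuous_on_compose_pair[OF continuous_on_chart_integrands(2)[OF that], of angle_box "\<lambda>_. a" "\<lambda>p. p"]
    by (auto intro!: integrable_continuous continuous_intros)
  have "chart_integrand_grad (\<lambda>xs x. Du xs x + e * Dv xs x) M k a
      = (\<lambda>p. chart_integrand_grad Du M k a p + e * chart_integrand_grad Dv M k a p)" for k
    by (simp add: fun_eq_iff chart_integrand_grad_def sum.distrib sum_distrib_left algebra_simps add_divide_distrib)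
  then show ?thesis
    unfolding chart_gradient_def
    by (simp add: vec_eq_iff integral_add integrable_on_mult_right integrable Du Dv)
qed

lemma has_vector_derivative_J1chart_line:
  assumes M0: "orthogonal_matrix M0"
    and Du: "derivative_tower Du" and u: "\<forall>x\<in>S3. u x = Du [] x"
    and Dv: "derivative_tower Dv" and v: "\<forall>x\<in>S3. v x = Dv [] x"
  shows "((\<lambda>\<epsilon>. J1chart M0 (\<lambda>x. u x + \<epsilon> * v x) (\<epsilon> *\<^sub>R b)) has_vector_derivative
           (b, chart_hessian Du M0 0 b + chart_gradient Dv M0 0)) (at 0)"
proof -
  have J1: "J1chart M0 (\<lambda>x. u x + \<epsilon> * v x) (\<epsilon> *\<^sub>R b) =
      (\<epsilon> *\<^sub>R b, chart_gradient Du M0 (\<epsilon> *\<^sub>R b) + \<epsilon> *\<^sub>R chart_gradient Dv M0 (\<epsilon> *\<^sub>R b))" for \<epsilon>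
    using J1chart_eq[OF M0 _ derivative_tower_lincomb[OF Du Dv]] chart_gradient_lincomb[OF Du Dv] u v
    by simp
  have line: "((\<lambda>\<epsilon>::real. \<epsilon> *\<^sub>R b) has_vector_derivative b) (at 0)"
    unfolding has_vector_derivative_def
    by (rule bounded_linear.has_derivative[OF bounded_linear_scaleR_left has_derivative_ident])
  have gradient_line: "((\<lambda>\<epsilon>. chart_gradient D M0 (\<epsilon> *\<^sub>R b)) has_vector_derivative chart_hessian D M0 0 b) (at 0)"
    if "derivative_tower D" for D
  proof -
    have "((\<lambda>\<epsilon>. chart_gradient D M0 (\<epsilon> *\<^sub>R b)) has_derivative (\<lambda>h. chart_hessian D M0 0 (h *\<^sub>R b))) (at 0)"
      using has_derivative_compose[OF line[unfolded has_vector_derivative_def]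
          has_derivative_chart_gradient[OF that]] by simp
    moreover have "chart_hessian D M0 0 (h *\<^sub>R b) = h *\<^sub>R chart_hessian D M0 0 b" for h
      by (simp add: chart_hessian_def vec_eq_iff sum_distrib_left mult.assoc)
    ultimately show ?thesis by (simp add: has_vector_derivative_def)
  qed
  have "((\<lambda>\<epsilon>. \<epsilon> *\<^sub>R chart_gradient Dv M0 (\<epsilon> *\<^sub>R b)) has_vector_derivative chart_gradient Dv M0 0) (at 0)"
    using has_vector_derivative_scaleR[OF DERIV_ident gradient_line[OF Dv]] by simp
  then show ?thesis
    unfolding J1 by (intro has_vector_derivative_Pair line has_vector_derivative_add gradient_line Du)
qed

section \<open>Polynomials with a prescribed gradient\<close>

text \<open>Polynomial expressions with symbolic partial derivatives: iterating them gives an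
  explicit derivative tower, hence smoothness.\<close>
datatype poly4 = PConst real | PLin "real^4" | PAdd poly4 poly4 | PMul poly4 poly4

fun poly4_eval :: "poly4 \<Rightarrow> real^4 \<Rightarrow> real" where
  "poly4_eval (PConst r) x = r"
| "poly4_eval (PLin w) x = w \<bullet> x"
| "poly4_eval (PAdd p q) x = poly4_eval p x + poly4_eval q x"
| "poly4_eval (PMul p q) x = poly4_eval p x * poly4_eval q x"

fun poly4_partial :: "4 \<Rightarrow> poly4 \<Rightarrow> poly4" where
  "poly4_partial i (PConst r) = PConst 0"
| "poly4_partial i (PLin w) = PConst (w $ i)"
| "poly4_partial i (PAdd p q) = PAdd (poly4_partial i p) (poly4_partial i q)"
| "poly4_partial i (PMul p q) = PAdd (PMul (poly4_partial i p) q) (PMul p (poly4_partial i q))"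

lemma has_derivative_poly4_eval:
  "(poly4_eval e has_derivative (\<lambda>h. \<Sum>i\<in>UNIV. h $ i * poly4_eval (poly4_partial i e) x)) (at x)"
proof (induction e)
  case (PConst r)
  then show ?case by simp
next
  case (PLin w)
  have "poly4_eval (PLin w) = (\<lambda>h. w \<bullet> h)" by (rule ext) simp
  then have "(poly4_eval (PLin w) has_derivative (\<lambda>h. w \<bullet> h)) (at x)"
    using bounded_linear.has_derivative[OF bounded_linear_inner_right has_derivative_ident, of w] by simp
  then show ?case by (rule has_derivative_eq_rhs) (simp add: fun_eq_iff inner_vec_def mult.commute)
next
  case (PAdd p q)
  show ?case
    using has_derivative_add[OF PAdd.IH] by (simp add: sum.distrib algebra_simps fun_eq_iff)
next
  case (PMul p q)
  show ?case
    using has_derivative_mult[OF PMul.IH]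
    by (simp add: fun_eq_iff sum_distrib_left sum_distrib_right sum.distrib[symmetric] algebra_simps)
qed

lemma derivative_tower_poly4: "derivative_tower (\<lambda>xs. poly4_eval (foldr poly4_partial xs e))"
  unfolding derivative_tower_def by (simp add: has_derivative_poly4_eval)

lemma poly4_restriction_in_Cinf_S3: "(\<lambda>x. if x \<in> S3 then poly4_eval e x else 0) \<in> Cinf_S3"
  unfolding Cinf_S3_def smooth4_iff_derivative_tower using derivative_tower_poly4[of e] by force

definition poly4_ddir :: "poly4 \<Rightarrow> real^4 \<Rightarrow> real^4 \<Rightarrow> real" where
  "poly4_ddir e x q = (\<Sum>j\<in>UNIV. poly4_eval (poly4_partial j e) x * q $ j)"

lemma poly4_ddir_simps [simp]:
  "poly4_ddir (PConst r) x q = 0"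
  "poly4_ddir (PLin w) x q = w \<bullet> q"
  "poly4_ddir (PAdd e1 e2) x q = poly4_ddir e1 x q + poly4_ddir e2 x q"
  "poly4_ddir (PMul e1 e2) x q = poly4_ddir e1 x q * poly4_eval e2 x + poly4_eval e1 x * poly4_ddir e2 x q"
  by (simp_all add: poly4_ddir_def inner_vec_def sum.distrib sum_distrib_left sum_distrib_right algebra_simps)

lemma poly4_ddir_orthogonal:
  assumes e: "\<And>y. poly4_eval e' y = poly4_eval e (transpose M *v y)" and M: "orthogonal_matrix M"
  shows "poly4_ddir e' (M *v p) (M *v q) = poly4_ddir e p q"
proof -
  define x where "x = M *v p"
  have "poly4_eval e' = (\<lambda>y. poly4_eval e (transpose M *v y))" using e by (simp add: fun_eq_iff)
  moreover have "((\<lambda>y. poly4_eval e (transpose M *v y)) has_derivative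
      (\<lambda>h. \<Sum>j\<in>UNIV. (transpose M *v h) $ j * poly4_eval (poly4_partial j e) (transpose M *v x))) (at x)"
    by (rule has_derivative_compose[OF bounded_linear.has_derivative[OF matrix_vector_mul_bounded_linear
        has_derivative_ident] has_derivative_poly4_eval])
  ultimately have "(poly4_eval e' has_derivative
      (\<lambda>h. \<Sum>j\<in>UNIV. (transpose M *v h) $ j * poly4_eval (poly4_partial j e) (transpose M *v x))) (at x)"
    by simp
  from has_derivative_unique[OF has_derivative_poly4_eval this]
  have "(\<Sum>i\<in>UNIV. (M *v q) $ i * poly4_eval (poly4_partial i e') x)
      = (\<Sum>j\<in>UNIV. (transpose M *v (M *v q)) $ j * poly4_eval (poly4_partial j e) (transpose M *v x))"
    by metis
  moreover have "transpose M *v (M *v q) = q" "transpose M *v x = p"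
    using M by (simp_all add: x_def matrix_vector_mul_assoc orthogonal_matrix_def)
  ultimately show ?thesis by (simp add: poly4_ddir_def x_def mult.commute)
qed

lemma has_integral_trig_products:
  "((\<lambda>x. cos x * cos x) has_integral pi) {0..2*pi}"
  "((\<lambda>x. sin x * sin x) has_integral pi) {0..2*pi}"
  "((\<lambda>x. cos x * sin x) has_integral 0) {0..2*pi}"
proof -
  have ftc: "(f has_integral F (2*pi) - F 0) {0..2*pi}"
    if "\<And>x. (F has_real_derivative f x) (at x)" for F f :: "real \<Rightarrow> real"
    using that
    by (intro fundamental_theorem_of_calculus)
       (auto simp: has_real_derivative_iff_has_vector_derivative[symmetric] intro: has_field_derivative_at_within)
  have pythagoras: "sin x * sin x + cos x * cos x = 1" for x :: real
    using sin_cos_squared_add[of x] by (simp add: power2_eq_square)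
  have "((\<lambda>x. x / 2 + sin x * cos x / 2) has_real_derivative cos x * cos x) (at x)"
    and "((\<lambda>x. x / 2 - sin x * cos x / 2) has_real_derivative sin x * sin x) (at x)"
    and "((\<lambda>x. sin x * sin x / 2) has_real_derivative cos x * sin x) (at x)" for x
    by (auto intro!: derivative_eq_intros simp: field_simps) (use pythagoras[of x] in algebra)+
  from ftc[OF this(1)] ftc[OF this(2)] ftc[OF this(3)]
  show "((\<lambda>x. cos x * cos x) has_integral pi) {0..2*pi}"
    "((\<lambda>x. sin x * sin x) has_integral pi) {0..2*pi}"
    "((\<lambda>x. cos x * sin x) has_integral 0) {0..2*pi}"
    by simp_all
qed

definition cos_or_sin :: "bool \<Rightarrow> real \<Rightarrow> real" where
  "cos_or_sin b = (if b then sin else cos)"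

lemma continuous_on_cos_or_sin: "continuous_on UNIV (cos_or_sin b)"
  by (simp add: cos_or_sin_def continuous_on_cos continuous_on_sin)

lemma has_integral_cos_or_sin_product:
  "((\<lambda>x. cos_or_sin a x * cos_or_sin b x) has_integral (if a = b then pi else 0)) {0..2*pi}"
  using has_integral_trig_products
  by (cases a; cases b) (simp_all add: cos_or_sin_def mult.commute)

lemma has_integral_angle_box_product:
  fixes \<phi> \<psi> :: "real \<Rightarrow> real"
  assumes A: "(\<phi> has_integral A) {0..2*pi}" and B: "(\<psi> has_integral B) {0..2*pi}"
    and "continuous_on UNIV \<phi>" "continuous_on UNIV \<psi>"
  shows "((\<lambda>p. \<phi> (fst p) * \<psi> (snd p)) has_integral (A * B)) angle_box"
proof -
  have cont: "continuous_on UNIV (\<lambda>p. \<phi> (fst p) * \<psi> (snd p))"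
    by (intro continuous_intros continuous_on_compose2[OF assms(3)] continuous_on_compose2[OF assms(4)]) auto
  have "integral angle_box (\<lambda>p. \<phi> (fst p) * \<psi> (snd p))
      = integral {0..2*pi} (\<lambda>s. integral {0..2*pi} (\<lambda>t. \<phi> s * \<psi> t))"
    by (rule integral_angle_box_iterated[where F="\<lambda>s t. \<phi> s * \<psi> t"]) (use cont in simp)
  also have "\<dots> = A * B"
    using A B by (simp add: integral_unique)
  finally show ?thesis
    using integrable_continuous[OF continuous_on_subset[OF cont]] by (metis has_integral_integrable_integral subset_UNIV)
qed

text \<open>The monomials \<open>x\<^sub>i x\<^sub>j\<close>, \<open>i \<in> {1,2}\<close>, \<open>j \<in> {3,4}\<close>, indexed like the
  generators of the chart.\<close>
definition torus_monomial :: "4 \<Rightarrow> real^4 \<Rightarrow> real" where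
  "torus_monomial k c = c $ (if k = 1 \<or> k = 2 then 1 else 2) * c $ (if k = 1 \<or> k = 3 then 3 else 4)"

lemma torus_monomial_cliff:
  "torus_monomial k (cliff s t) = cos_or_sin (k = 3 \<or> k = 4) s * cos_or_sin (k = 2 \<or> k = 4) t / 2"
  using exhaust_4[of k] by (auto simp: torus_monomial_def cos_or_sin_def)

lemma has_integral_torus_monomial_products:
  "((\<lambda>p. torus_monomial k (cliff_pt p) * torus_monomial j (cliff_pt p))
      has_integral (if k = j then pi\<^sup>2 / 4 else 0)) angle_box"
proof -
  let ?a = "\<lambda>k::4. k = 3 \<or> k = 4" and ?b = "\<lambda>k::4. k = 2 \<or> k = 4"
  have "((\<lambda>p. (cos_or_sin (?a k) (fst p) * cos_or_sin (?a j) (fst p))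
      * (cos_or_sin (?b k) (snd p) * cos_or_sin (?b j) (snd p)) / 4)
      has_integral (if ?a k = ?a j then pi else 0) * (if ?b k = ?b j then pi else 0) / 4) angle_box"
    by (intro has_integral_divide has_integral_angle_box_product has_integral_cos_or_sin_product
        continuous_intros continuous_on_cos_or_sin)
  moreover have "(if ?a k = ?a j then pi else 0) * (if ?b k = ?b j then pi else 0) / 4
      = (if k = j then pi\<^sup>2 / 4 else 0)"
    using exhaust_4[of k] exhaust_4[of j] by (auto simp: power2_eq_square)
  ultimately show ?thesis
    by (simp add: torus_monomial_cliff mult_ac)
qed

definition frame_coord :: "real^4^4 \<Rightarrow> 4 \<Rightarrow> poly4" where
  "frame_coord M j = PLin (M *v axis j 1)"

lemma poly4_eval_frame_coord [simp]: "poly4_eval (frame_coord M j) x = (transpose M *v x) $ j"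
  by (simp add: frame_coord_def inner_vec_def matrix_vector_mult_def transpose_def axis_def
      if_distrib mult.commute cong: if_cong)

definition torus_quadric :: "real^4^4 \<Rightarrow> poly4" where
  "torus_quadric M = PAdd
     (PAdd (PMul (frame_coord M 1) (frame_coord M 1)) (PMul (frame_coord M 2) (frame_coord M 2)))
     (PAdd (PMul (PConst (-1)) (PMul (frame_coord M 3) (frame_coord M 3)))
           (PMul (PConst (-1)) (PMul (frame_coord M 4) (frame_coord M 4))))"

definition torus_bilinear :: "real^4^4 \<Rightarrow> real^4 \<Rightarrow> poly4" where
  "torus_bilinear M l = PAdd
     (PAdd (PMul (PConst (l$1)) (PMul (frame_coord M 1) (frame_coord M 3)))
           (PMul (PConst (l$2)) (PMul (frame_coord M 1) (frame_coord M 4))))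
     (PAdd (PMul (PConst (l$3)) (PMul (frame_coord M 2) (frame_coord M 3)))
           (PMul (PConst (l$4)) (PMul (frame_coord M 2) (frame_coord M 4))))"

text \<open>The quadric factor vanishes on the Clifford torus of frame M, so in the first variation
  only its derivative along the generators contributes, and that derivative is
  -4 times the matching monomial of the bilinear factor.\<close>
definition gradient_witness :: "real^4^4 \<Rightarrow> real^4 \<Rightarrow> poly4" where
  "gradient_witness M l = PMul (torus_quadric M) (torus_bilinear M l)"

lemma poly4_eval_gradient_witness_frame:
  "poly4_eval (gradient_witness M l) y = poly4_eval (gradient_witness (mat 1) l) (transpose M *v y)"
  by (simp add: gradient_witness_def torus_quadric_def torus_bilinear_def)

lemma torus_quadric_cliff: "poly4_eval (torus_quadric (mat 1)) (cliff s t) = 0"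
proof -
  have "poly4_eval (torus_quadric (mat 1)) (cliff s t)
      = (cos s)\<^sup>2 / 2 + (sin s)\<^sup>2 / 2 - ((cos t)\<^sup>2 / 2 + (sin t)\<^sup>2 / 2)"
    by (simp add: torus_quadric_def power2_eq_square algebra_simps)
  also have "\<dots> = 0"
    using sin_cos_squared_add[of s] sin_cos_squared_add[of t] by linarith
  finally show ?thesis .
qed

lemma poly4_eval_torus_bilinear:
  "poly4_eval (torus_bilinear (mat 1) l) c = (\<Sum>k\<in>UNIV. l$k * torus_monomial k c)"
  by (simp add: torus_bilinear_def torus_monomial_def sum_4)

lemma torus_quadric_ddir_generator:
  "poly4_ddir (torus_quadric (mat 1)) c (chart_diff (mat 1) (unit_index k) 0 c) = -4 * torus_monomial k c"
  using exhaust_4[of k]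
  by (auto simp: torus_quadric_def torus_monomial_def chart_diff_def rot_diff_def unit_index_def
      frame_coord_def inner_axis')

lemma rot_diff_origin [simp]: "rot_diff i j 0 0 w = w"
  by (simp add: rot_diff_def vec_eq_iff)

lemma chart_integrand_grad_witness:
  assumes M: "orthogonal_matrix M"
  shows "chart_integrand_grad (\<lambda>xs. poly4_eval (foldr poly4_partial xs (gradient_witness M l))) M k 0 p
       = -2 * (\<Sum>j\<in>UNIV. l$j * (torus_monomial k (cliff_pt p) * torus_monomial j (cliff_pt p)))"
proof -
  let ?c = "cliff_pt p" and ?E = "chart_diff (mat 1) (unit_index k) 0 (cliff_pt p)"
  have "chart_integrand_grad (\<lambda>xs. poly4_eval (foldr poly4_partial xs (gradient_witness M l))) M k 0 p
      = poly4_ddir (gradient_witness M l) (M *v ?c) (M *v ?E) / 2"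
    by (simp add: chart_integrand_grad_def poly4_ddir_def chart_diff_matrix[of M] chart_diff_def)
  also have "\<dots> = poly4_ddir (gradient_witness (mat 1) l) ?c ?E / 2"
    by (simp add: poly4_ddir_orthogonal[OF poly4_eval_gradient_witness_frame M])
  also have "\<dots> = -2 * torus_monomial k ?c * poly4_eval (torus_bilinear (mat 1) l) ?c"
    by (simp add: gradient_witness_def torus_quadric_cliff torus_quadric_ddir_generator)
  finally show ?thesis
    by (simp add: poly4_eval_torus_bilinear sum_distrib_left mult_ac)
qed

lemma chart_gradient_witness:
  assumes "orthogonal_matrix M"
  shows "chart_gradient (\<lambda>xs. poly4_eval (foldr poly4_partial xs (gradient_witness M l))) M 0
       = (- (pi\<^sup>2 / 2)) *\<^sub>R l"
proof -
  have "integral angle_box (chart_integrand_grad (\<lambda>xs. poly4_eval (foldr poly4_partial xs (gradient_witness M l))) M k 0)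
      = - (pi\<^sup>2 / 2) * l$k" for k
  proof -
    have integrand: "chart_integrand_grad (\<lambda>xs. poly4_eval (foldr poly4_partial xs (gradient_witness M l))) M k 0
        = (\<lambda>p. -2 * (\<Sum>j\<in>UNIV. l$j * (torus_monomial k (cliff_pt p) * torus_monomial j (cliff_pt p))))"
      using chart_integrand_grad_witness[OF assms] by (simp add: fun_eq_iff)
    have "((\<lambda>p. -2 * (\<Sum>j\<in>UNIV. l$j * (torus_monomial k (cliff_pt p) * torus_monomial j (cliff_pt p))))
        has_integral -2 * (\<Sum>j\<in>UNIV. l$j * (if k = j then pi\<^sup>2 / 4 else 0))) angle_box"
      by (intro has_integral_mult_right has_integral_sum has_integral_torus_monomial_products) auto
    from integral_unique[OF this] show ?thesis
      by (simp add: integrand if_distrib[of "\<lambda>x. _ * x"] cong: if_cong)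
  qed
  then show ?thesis by (simp add: chart_gradient_def vec_eq_iff)
qed

lemma chart_gradient_surjective:
  assumes "orthogonal_matrix M"
  obtains v D where "v \<in> Cinf_S3" "derivative_tower D" "\<forall>x\<in>S3. v x = D [] x" "chart_gradient D M 0 = g"
proof -
  define e where "e = gradient_witness M ((- 2 / pi\<^sup>2) *\<^sub>R g)"
  show thesis
  proof (rule that)
    show "(\<lambda>x. if x \<in> S3 then poly4_eval e x else 0) \<in> Cinf_S3"
      by (rule poly4_restriction_in_Cinf_S3)
    show "derivative_tower (\<lambda>xs. poly4_eval (foldr poly4_partial xs e))"
      by (rule derivative_tower_poly4)
    show "\<forall>x\<in>S3. (if x \<in> S3 then poly4_eval e x else 0) = poly4_eval (foldr poly4_partial [] e) x"
      by simp
    show "chart_gradient (\<lambda>xs. poly4_eval (foldr poly4_partial xs e)) M 0 = g"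
      unfolding e_def chart_gradient_witness[OF assms] by simp
  qed
qed

theorem lemma3p4:
  assumes "orthogonal_matrix M0" and "u \<in> Cinf_S3"
  shows "\<exists>L. (\<forall>v\<in>Cinf_S3. \<forall>b. ((\<lambda>\<epsilon>. J1chart M0 (\<lambda>x. u x + \<epsilon> * v x) (\<epsilon> *\<^sub>R b))
                 has_vector_derivative L v b) (at 0))
           \<and> (\<forall>w. \<exists>v\<in>Cinf_S3. \<exists>b. L v b = w)"
proof -
  obtain Du where Du: "derivative_tower Du" "\<forall>x\<in>S3. u x = Du [] x"
    using Cinf_S3_derivative_tower[OF assms(2)] .
  define L where "L v b = vector_derivative (\<lambda>\<epsilon>. J1chart M0 (\<lambda>x. u x + \<epsilon> * v x) (\<epsilon> *\<^sub>R b)) (at 0)"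
    for v b
  note derivative = has_vector_derivative_J1chart_line[OF assms(1) Du]
  have L_eq: "L v b = (b, chart_hessian Du M0 0 b + chart_gradient Dv M0 0)"
    if "derivative_tower Dv" "\<forall>x\<in>S3. v x = Dv [] x" for v Dv b
    unfolding L_def by (rule vector_derivative_at[OF derivative[OF that]])
  show ?thesis
  proof (intro exI[of _ L] conjI ballI allI)
    fix v b assume "v \<in> Cinf_S3"
    then obtain Dv where Dv: "derivative_tower Dv" "\<forall>x\<in>S3. v x = Dv [] x"
      by (rule Cinf_S3_derivative_tower)
    show "((\<lambda>\<epsilon>. J1chart M0 (\<lambda>x. u x + \<epsilon> * v x) (\<epsilon> *\<^sub>R b)) has_vector_derivative L v b) (at 0)"
      unfolding L_eq[OF Dv] by (rule derivative[OF Dv])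
  next
    fix w :: "(real^4) \<times> (real^4)"
    obtain v Dv where v: "v \<in> Cinf_S3" "derivative_tower Dv" "\<forall>x\<in>S3. v x = Dv [] x"
      and "chart_gradient Dv M0 0 = snd w - chart_hessian Du M0 0 (fst w)"
      by (rule chart_gradient_surjective[OF assms(1)])
    with L_eq[OF v(2,3)] have "L v (fst w) = w" by simp
    with v(1) show "\<exists>v\<in>Cinf_S3. \<exists>b. L v b = w" by blast
  qed
qed

end
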